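(* Let $Q=\{x\in\mathbb{R}^n_+\mid Ax\ge b\}$ be a covering polyhedron with $A_{ij}\le b_i$ for all $i\in[m]$, $j\in[n]$, and let $k\ge1$ be an integer. Then for every objective $c\in\mathbb{R}^n_+$ with $0<z^{LP}<\infty$, $$\operatorname{rank}_{\mathcal{A}_k}(Q)\ \ge\ \left\lceil\frac{\log_2\left(z^I/z^{LP}\right)}{3+\log_2\log_2(2k)}\right\rceil .$$
   Context: A covering polyhedron is $\{x\in\mathbb{R}^n_+\mid Ax\ge b\}$ with $A\in\mathbb{Q}^{m\times n},b\in\mathbb{Q}^m$ entrywise non-negative. A covering set is a set $\{x\in\mathbb{R}^n_+\mid A^ix\ge b_i\ \forall i\in I\}$ with $I$ an arbitrary index set and each $(A^i,b_i)\in\mathbb{R}^{1\times n}_+\times\mathbb{R}_+$. $Q^I=\operatorname{conv}(Q\cap\mathbb{Z}^n)$ is the integer hull. For a covering set $Q$, the $k$-aggregation closure $\mathcal{A}_k(Q)$ is the intersection of all sets $\operatorname{conv}(\{x\in\mathbb{Z}^n_+\mid D^jx\ge f_j\ \forall j\in[k]\})$ over all choices of $k$ inequalities $D^jx\ge f_j$ with non-negative coefficients that are valid for $Q$. $\mathcal{A}_k(Q)$ is again a covering set. $\operatorname{rank}_{\mathcal{A}_k}(Q)$ is the minimum number of iterated applications of $\mathcal{A}_k$, starting from $Q$, needed to obtain $Q^I$ (this is finite). For an objective $c$: $z^{LP}=\min\{c^\top x\mid x\in Q\}$ and $z^I=\min\{c^\top x\mid x\in Q^I\}$. *)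

theory Defs
  imports "HOL-Analysis.Analysis"
begin

definition nonneg_vec :: "real^'n \<Rightarrow> bool" where
  "nonneg_vec x \<longleftrightarrow> (\<forall>j. 0 \<le> x $ j)"

definition int_points :: "(real^'n) set" where
  "int_points = {x. \<forall>j. x $ j \<in> \<int>}"

definition covering_polyhedron :: "real^'n^'m \<Rightarrow> real^'m \<Rightarrow> (real^'n) set" where
  "covering_polyhedron A b = {x. nonneg_vec x \<and> (\<forall>i. b $ i \<le> (A *v x) $ i)}"

definition integer_hull :: "(real^'n) set \<Rightarrow> (real^'n) set" where
  "integer_hull Q = convex hull (Q \<inter> int_points)"

definition valid_covering_ineq :: "(real^'n) set \<Rightarrow> real^'n \<Rightarrow> real \<Rightarrow> bool" where
  "valid_covering_ineq Q d f \<longleftrightarrow> nonneg_vec d \<and> 0 \<le> f \<and> (\<forall>x\<in>Q. f \<le> d \<bullet> x)"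

text \<open>Only the values of \<open>D\<close> and \<open>f\<close> at indices below \<open>k\<close> matter. Requiring \<open>0 \<le> f j\<close>
  does not change the closure: on the non-negative orthant, a right-hand side \<open>f j < 0\<close> cuts
  off nothing, and neither does \<open>f j = 0\<close>.\<close>

definition aggregation_closure :: "nat \<Rightarrow> (real^'n) set \<Rightarrow> (real^'n) set" where
  "aggregation_closure k Q =
     \<Inter> {convex hull {x \<in> int_points. nonneg_vec x \<and> (\<forall>j<k. f j \<le> D j \<bullet> x)} | D f.
          \<forall>j<k. valid_covering_ineq Q (D j) (f j)}"

text \<open>The infimum is the least number of iterations whenever some number of iterations
  suffices; otherwise it is \<open>\<infinity>\<close>.\<close>

definition aggregation_rank :: "nat \<Rightarrow> (real^'n) set \<Rightarrow> enat" where
  "aggregation_rank k Q = Inf {enat t | t. (aggregation_closure k ^^ t) Q = integer_hull Q}"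

text \<open>Extended-real valued, so that an infeasible problem has value \<open>\<infinity>\<close>. For a covering
  polyhedron with non-negative rational data, its integer hull, and a non-negative objective,
  the infimum is attained whenever it is finite.\<close>

definition opt_value :: "real^'n \<Rightarrow> (real^'n) set \<Rightarrow> ereal" where
  "opt_value c S = (INF x\<in>S. ereal (c \<bullet> x))"

end

theory Submission
  imports Defs
begin

text \<open>Put \<open>\<alpha> = 8 log\<^sub>2 (2k)\<close>, so that \<open>log\<^sub>2 \<alpha> = 3 + log\<^sub>2 log\<^sub>2 (2k)\<close>. The point is that one
  application of the closure raises the optimal value by a factor of at most \<open>\<alpha>\<close>, because
  \<open>x \<in> Q\<close> implies \<open>\<alpha> x \<in> \<A>\<^sub>k(Q)\<close>.

  The hypothesis \<open>A\<^sub>i\<^sub>j \<le> b\<^sub>i\<close> enters through a geometric consequence that survives the closure: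
  if \<open>x \<in> Q\<close> and the coordinates in \<open>S\<close> sum to \<open>s < 1\<close>, then setting them to zero and dividing by
  \<open>1 - s\<close> gives a point of \<open>Q\<close> again. For a set with this property, every valid inequality
  \<open>d x \<ge> f\<close> may be truncated to \<open>min(d, f) x \<ge> f\<close>, which has the same integer solutions.
  Given \<open>k\<close> truncated inequalities, independent randomized rounding of \<open>4 log\<^sub>2 (2k) x\<close>
  satisfies each of them except with probability at most \<open>1 / 2k\<close>, by a Chernoff bound.
  Conditioning on the success of all of them at most doubles the expectation, which places \<open>\<alpha> x\<close>
  above a convex combination of integer solutions.\<close>

subsection \<open>Zeroing coordinates\<close>

definition deletion_stable :: "(real^'n) set \<Rightarrow> bool" where
  "deletion_stable Q \<longleftrightarrow> (\<forall>x\<in>Q. nonneg_vec x \<and>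
     (\<forall>S. (\<Sum>j\<in>S. x $ j) < 1 \<longrightarrow>
        (\<chi> j. if j \<in> S then 0 else x $ j / (1 - (\<Sum>j\<in>S. x $ j))) \<in> Q))"

text \<open>Row \<open>i\<close> loses at most \<open>b $ i * s\<close>, as each deleted coefficient
  is at most \<open>b $ i\<close>. At least \<open>b $ i * (1 - s)\<close> remains, and the division
  restores \<open>b $ i\<close>.\<close>

lemma deletion_stable_covering_polyhedron:
  fixes A :: "real^'n^'m"
  assumes "\<And>i j. A $ i $ j \<le> b $ i"
  shows "deletion_stable (covering_polyhedron A b)"
  unfolding deletion_stable_def
proof (intro ballI conjI allI impI)
  fix x assume x: "x \<in> covering_polyhedron A b"
  then show nn: "nonneg_vec x" by (simp add: covering_polyhedron_def)
  fix S :: "'n set"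
  define s where "s = (\<Sum>j\<in>S. x $ j)"
  define y :: "real^'n" where "y = (\<chi> j. if j \<in> S then 0 else x $ j / (1 - s))"
  assume "(\<Sum>j\<in>S. x $ j) < 1"
  then have s1: "s < 1" by (simp add: s_def)
  have "b $ i \<le> (A *v y) $ i" for i
  proof -
    have Ay: "(A *v y) $ i = (\<Sum>j\<in>-S. A $ i $ j * x $ j) / (1 - s)"
      by (simp add: matrix_vector_mult_def y_def sum_divide_distrib if_distrib sum.If_cases
          cong: if_cong)
    have "b $ i \<le> (\<Sum>j\<in>UNIV. A $ i $ j * x $ j)"
      using x by (simp add: covering_polyhedron_def matrix_vector_mult_def)
    also have "\<dots> = (\<Sum>j\<in>S. A $ i $ j * x $ j) + (\<Sum>j\<in>-S. A $ i $ j * x $ j)"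
      using sum.subset_diff[of S UNIV "\<lambda>j. A $ i $ j * x $ j"]
      by (simp add: Compl_eq_Diff_UNIV add.commute)
    also have "(\<Sum>j\<in>S. A $ i $ j * x $ j) \<le> (\<Sum>j\<in>S. b $ i * x $ j)"
      using assms nn by (intro sum_mono mult_right_mono) (auto simp: nonneg_vec_def)
    also have "\<dots> = b $ i * s" by (simp add: s_def sum_distrib_left)
    finally have "b $ i * (1 - s) \<le> (\<Sum>j\<in>-S. A $ i $ j * x $ j)"
      by (simp add: algebra_simps)
    then show ?thesis using s1 by (simp add: Ay pos_le_divide_eq)
  qed
  moreover have "nonneg_vec y" using nn s1 by (simp add: nonneg_vec_def y_def)
  ultimately show "(\<chi> j. if j \<in> S then 0 else x $ j / (1 - (\<Sum>j\<in>S. x $ j)))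
      \<in> covering_polyhedron A b"
    unfolding s_def[symmetric] y_def[symmetric] by (simp add: covering_polyhedron_def)
qed

text \<open>The modified point depends on \<open>x\<close> and \<open>S\<close> but not on the set.
  The empty family is excluded because its intersection is the whole space, which has points with
  negative entries.\<close>

lemma deletion_stable_Inter:
  assumes "\<F> \<noteq> {}" "\<And>Q. Q \<in> \<F> \<Longrightarrow> deletion_stable Q"
  shows "deletion_stable (\<Inter>\<F>)"
  using assms unfolding deletion_stable_def by blast

text \<open>If \<open>x\<close> has mass at least 1 on the coordinates with
  \<open>d $ j > f\<close>, these alone contribute \<open>f\<close>. Otherwise they are deleted, and
  the original inequality at the new point involves untruncated coefficients only.\<close>

lemma truncated_ineq_valid:
  fixes d :: "real^'n"
  assumes Q: "deletion_stable Q" and d: "valid_covering_ineq Q d f" and x: "x \<in> Q"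
  shows "f \<le> (\<chi> j. min (d $ j) f) \<bullet> x"
proof -
  define S where "S = {j. f < d $ j}"
  define s where "s = (\<Sum>j\<in>S. x $ j)"
  have nn: "0 \<le> x $ j" for j
    using Q x by (simp add: deletion_stable_def nonneg_vec_def)
  have f: "0 \<le> f" and dn: "0 \<le> d $ j" for j
    using d by (simp_all add: valid_covering_ineq_def nonneg_vec_def)
  have eq: "(\<chi> j. min (d $ j) f) \<bullet> x = f * s + (\<Sum>j\<in>-S. d $ j * x $ j)"
  proof -
    have "(\<chi> j. min (d $ j) f) \<bullet> x
        = (\<Sum>j\<in>UNIV. if j \<in> S then f * x $ j else d $ j * x $ j)"
      unfolding inner_vec_def by (intro sum.cong) (auto simp: S_def min_def)
    then show ?thesis
      by (simp add: sum.If_cases s_def sum_distrib_left)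
  qed
  have rest: "0 \<le> (\<Sum>j\<in>-S. d $ j * x $ j)"
    using nn dn by (intro sum_nonneg) simp
  show ?thesis
  proof (cases "s < 1")
    case False
    then have "f * 1 \<le> f * s" using f by (intro mult_left_mono) auto
    then show ?thesis using rest eq by simp
  next
    case True
    define y :: "real^'n" where "y = (\<chi> j. if j \<in> S then 0 else x $ j / (1 - s))"
    have "y \<in> Q"
      using Q x True unfolding deletion_stable_def y_def s_def by blast
    then have "f \<le> d \<bullet> y" using d by (simp add: valid_covering_ineq_def)
    also have "\<dots> = (\<Sum>j\<in>-S. d $ j * x $ j) / (1 - s)"
      by (simp add: inner_vec_def y_def sum_divide_distrib if_distrib sum.If_cases cong: if_cong)
    finally have "f * (1 - s) \<le> (\<Sum>j\<in>-S. d $ j * x $ j)"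
      using True by (simp add: pos_le_divide_eq)
    then show ?thesis by (simp add: eq algebra_simps)
  qed
qed

subsection \<open>Convex hulls of upward closed sets of integer points\<close>

definition int_upclosed :: "(real^'n) set \<Rightarrow> bool" where
  "int_upclosed X \<longleftrightarrow> X \<subseteq> int_points \<and> (\<forall>x\<in>X. nonneg_vec x) \<and>
     (\<forall>x\<in>X. \<forall>a\<in>int_points. nonneg_vec a \<longrightarrow> a + x \<in> X)"

text \<open>A real step along an axis is a fraction of an integer step, and integer steps preserve
  the hull; \<open>y - x\<close> is a sum of such real steps.\<close>

lemma convex_hull_int_upclosed_mono:
  fixes x y :: "real^'n"
  assumes X: "int_upclosed X" and x: "x \<in> convex hull X" and le: "\<And>j. x $ j \<le> y $ j"
  shows "y \<in> convex hull X"
proof -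
  have shift: "a + v \<in> convex hull X"
    if "a \<in> int_points" "nonneg_vec a" "v \<in> convex hull X" for a v
  proof -
    have "a + v \<in> convex hull ((\<lambda>x. a + x) ` X)"
      using that by (simp add: convex_hull_translation)
    moreover have "(\<lambda>x. a + x) ` X \<subseteq> X"
      using X that by (auto simp: int_upclosed_def)
    ultimately show ?thesis using hull_mono by blast
  qed
  have ray: "v + r *\<^sub>R axis i 1 \<in> convex hull X" if "0 \<le> r" and v: "v \<in> convex hull X" for v i r
  proof (cases "r = 0")
    case False
    obtain N :: nat where N: "r < real N" using reals_Archimedean2 by blast
    have "real N *\<^sub>R axis i 1 + v \<in> convex hull X"
      by (rule shift[OF _ _ v]) (auto simp: int_points_def nonneg_vec_def axis_def)
    then have "(1 - r / N) *\<^sub>R v + (r / N) *\<^sub>R (real N *\<^sub>R axis i 1 + v) \<in> convex hull X"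
      using v that(1) N by (intro convexD[OF convex_convex_hull]) auto
    moreover have "(1 - r / N) *\<^sub>R v + (r / N) *\<^sub>R (real N *\<^sub>R axis i 1 + v) = v + r *\<^sub>R axis i 1"
      using that(1) N by (simp add: algebra_simps)
    ultimately show ?thesis by simp
  qed (use v in simp)
  have "x + (\<Sum>i\<in>I. (y $ i - x $ i) *\<^sub>R axis i 1) \<in> convex hull X" if "finite I" for I
    using that
  proof (induction I)
    case (insert i I)
    have "x + (\<Sum>i\<in>insert i I. (y $ i - x $ i) *\<^sub>R axis i 1)
        = (x + (\<Sum>i\<in>I. (y $ i - x $ i) *\<^sub>R axis i 1)) + (y $ i - x $ i) *\<^sub>R axis i 1"
      using insert by (simp add: algebra_simps)
    then show ?case using ray[OF _ insert.IH, of "y $ i - x $ i" i] le[of i] by (simp add: add.assoc)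
  qed (use x in simp)
  from this[of UNIV] show ?thesis
    using basis_expansion[of "y - x"] by (simp add: scalar_mult_eq_scaleR)
qed

text \<open>A positive integer entry is at least 1. This gap lets the mass of a convex combination
  on \<open>S\<close> bound the weight of those of its points that do not vanish on
  \<open>S\<close>.\<close>

lemma int_nonneg_sum_ge_1:
  assumes "v \<in> int_points" "nonneg_vec v" "i \<in> S" "v $ i \<noteq> 0"
  shows "1 \<le> (\<Sum>j\<in>S. v $ j)"
proof -
  obtain m :: int where m: "v $ i = of_int m"
    using assms(1) by (auto simp: int_points_def Ints_def)
  then have "0 \<le> m" "m \<noteq> 0"
    using assms(2,4) by (auto simp: nonneg_vec_def dest: spec[of _ i])
  then have "1 \<le> v $ i" by (simp add: m)
  also have "\<dots> \<le> (\<Sum>j\<in>S. v $ j)"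
    using assms(2,3) by (intro member_le_sum) (auto simp: nonneg_vec_def)
  finally show ?thesis .
qed

text \<open>In a convex combination giving \<open>x\<close>, only the points vanishing on
  \<open>S\<close> are kept. Integrality bounds the discarded weight by \<open>s\<close>, so
  renormalizing the rest enlarges coordinates by a factor of at most
  \<open>1 / (1 - s)\<close>.\<close>

lemma deletion_stable_convex_hull:
  fixes X :: "(real^'n) set"
  assumes X: "int_upclosed X"
  shows "deletion_stable (convex hull X)"
  unfolding deletion_stable_def
proof (intro ballI conjI allI impI)
  fix x assume "x \<in> convex hull X"
  then obtain F u where F: "finite F" "F \<subseteq> X" "\<And>v. v \<in> F \<Longrightarrow> 0 \<le> u v" "sum u F = 1"
      and x: "x = (\<Sum>v\<in>F. u v *\<^sub>R v)"
    unfolding convex_hull_explicit by auto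
  have Fn: "0 \<le> v $ j" if "v \<in> F" for v j
    using that F X by (auto simp: int_upclosed_def nonneg_vec_def)
  have xj: "x $ j = (\<Sum>v\<in>F. u v * v $ j)" for j by (simp add: x)
  show "nonneg_vec x"
    using F Fn by (auto simp: nonneg_vec_def xj intro!: sum_nonneg)
  fix S :: "'n set"
  define s where "s = (\<Sum>j\<in>S. x $ j)"
  assume "(\<Sum>j\<in>S. x $ j) < 1"
  then have s1: "s < 1" by (simp add: s_def)
  define F0 where "F0 = {v\<in>F. \<forall>j\<in>S. v $ j = 0}"
  define w where "w = sum u F0"
  have F0: "F0 \<subseteq> F" "finite F0" using F by (auto simp: F0_def)
  have "sum u F = sum u (F - F0) + w"
    unfolding w_def using F0 F by (intro sum.subset_diff) auto
  then have "1 - w = (\<Sum>v\<in>F - F0. u v * 1)" using F by simp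
  also have "\<dots> \<le> (\<Sum>v\<in>F - F0. u v * (\<Sum>j\<in>S. v $ j))"
  proof (intro sum_mono mult_left_mono)
    fix v assume v: "v \<in> F - F0"
    then obtain i where "i \<in> S" "v $ i \<noteq> 0" by (auto simp: F0_def)
    then show "1 \<le> (\<Sum>j\<in>S. v $ j)"
      using v F X by (intro int_nonneg_sum_ge_1) (auto simp: int_upclosed_def)
  qed (use F in auto)
  also have "\<dots> \<le> (\<Sum>v\<in>F. u v * (\<Sum>j\<in>S. v $ j))"
    using F Fn by (intro sum_mono2) (auto intro!: mult_nonneg_nonneg sum_nonneg)
  also have "\<dots> = (\<Sum>j\<in>S. \<Sum>v\<in>F. u v * v $ j)"
    by (subst sum.swap) (simp add: sum_distrib_left)
  also have "\<dots> = s" by (simp add: s_def xj)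
  finally have w: "1 - s \<le> w" by simp
  with s1 have w0: "0 < w" by simp
  \<comment> \<open>It is enough that \<open>y\<close> lies below the required point, by upward
    closure of the hull: discarded points may have contributed outside \<open>S\<close>, and
    \<open>w\<close> may exceed \<open>1 - s\<close>.\<close>
  define y where "y = (\<Sum>v\<in>F0. (u v / w) *\<^sub>R v)"
  have "y \<in> convex hull X"
    unfolding y_def
  proof (intro convex_sum[OF F0(2) convex_convex_hull])
    show "(\<Sum>v\<in>F0. u v / w) = 1"
      using w0 by (simp add: w_def flip: sum_divide_distrib)
  qed (use F F0 w0 in \<open>auto intro: hull_inc\<close>)
  moreover have "y $ j \<le> (\<chi> j. if j \<in> S then 0 else x $ j / (1 - s)) $ j" for j
  proof (cases "j \<in> S")
    case True
    then have "y $ j = 0" by (simp add: y_def F0_def)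
    then show ?thesis using True by simp
  next
    case False
    have "y $ j = (\<Sum>v\<in>F0. u v * v $ j) / w" by (simp add: y_def sum_divide_distrib)
    also have "\<dots> \<le> x $ j / (1 - s)"
    proof (rule frac_le)
      show "0 \<le> x $ j" using F Fn by (auto simp: xj intro!: sum_nonneg)
      show "(\<Sum>v\<in>F0. u v * v $ j) \<le> x $ j"
        unfolding xj using F F0 Fn by (intro sum_mono2) auto
    qed (use s1 w in auto)
    finally show ?thesis using False by simp
  qed
  ultimately show "(\<chi> j. if j \<in> S then 0 else x $ j / (1 - (\<Sum>j\<in>S. x $ j))) \<in> convex hull X"
    unfolding s_def[symmetric] by (rule convex_hull_int_upclosed_mono[OF X])
qed

lemma int_upclosed_covering:
  assumes "\<And>j. j < k \<Longrightarrow> nonneg_vec (D j)"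
  shows "int_upclosed {x \<in> int_points. nonneg_vec x \<and> (\<forall>j<k. f j \<le> D j \<bullet> (x :: real^'n))}"
proof -
  have "0 \<le> D j \<bullet> a" if "j < k" "nonneg_vec a" for j and a :: "real^'n"
    using assms that by (auto simp: inner_vec_def nonneg_vec_def intro!: sum_nonneg)
  then show ?thesis
    by (auto simp: int_upclosed_def int_points_def nonneg_vec_def inner_add_right
        intro!: add_increasing)
qed

lemma deletion_stable_aggregation_closure: "deletion_stable (aggregation_closure k Q)"
  unfolding aggregation_closure_def
proof (rule deletion_stable_Inter)
  \<comment> \<open>The trivial inequality is valid for every set, so the intersected family is
    non-empty.\<close>
  have "\<forall>j<k. valid_covering_ineq Q 0 0"
    by (simp add: valid_covering_ineq_def nonneg_vec_def)
  then show "{convex hull {x \<in> int_points. nonneg_vec x \<and> (\<forall>j<k. f j \<le> D j \<bullet> x)} | D f.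
      \<forall>j<k. valid_covering_ineq Q (D j) (f j)} \<noteq> {}"
    by fastforce
qed (auto intro!: deletion_stable_convex_hull int_upclosed_covering
    simp: valid_covering_ineq_def)

subsection \<open>Randomized rounding\<close>

text \<open>For \<open>p\<close> with values in the unit interval, this is the probability that
  \<open>T\<close> is the set of successes of independent trials with success probabilities
  \<open>p i\<close>. Finite sums over all \<open>T\<close> serve as expectations.\<close>

definition subset_weight :: "('n \<Rightarrow> real) \<Rightarrow> ('n::finite) set \<Rightarrow> real" where
  "subset_weight p T = (\<Prod>i\<in>UNIV. if i \<in> T then p i else 1 - p i)"

lemma subset_weight_nonneg:
  assumes "\<And>i. 0 \<le> p i" "\<And>i. p i \<le> 1"
  shows "0 \<le> subset_weight p T"
  using assms by (auto simp: subset_weight_def intro!: prod_nonneg)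

text \<open>Independence: the mean of a product of factors, found by expanding the right-hand
  product over subsets. Total weight, marginals and the exponential moment are all
  instances.\<close>

lemma sum_subset_weight_prod:
  fixes p :: "'n::finite \<Rightarrow> real"
  shows "(\<Sum>T\<in>UNIV. subset_weight p T * (\<Prod>i\<in>UNIV. if i \<in> T then g i else h i))
    = (\<Prod>i\<in>UNIV. p i * g i + (1 - p i) * h i)"
proof -
  have "subset_weight p T * (\<Prod>i\<in>UNIV. if i \<in> T then g i else h i)
      = (\<Prod>i\<in>T. p i * g i) * (\<Prod>i\<in>UNIV - T. (1 - p i) * h i)" for T
  proof -
    have "subset_weight p T * (\<Prod>i\<in>UNIV. if i \<in> T then g i else h i)
        = (\<Prod>i\<in>UNIV. if i \<in> T then p i * g i else (1 - p i) * h i)"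
      unfolding subset_weight_def prod.distrib[symmetric] by (intro prod.cong) auto
    then show ?thesis by (simp add: prod.If_cases Compl_eq_Diff_UNIV)
  qed
  then show ?thesis by (simp add: prod_add)
qed

lemma sum_subset_weight: "(\<Sum>T\<in>UNIV. subset_weight p T) = 1"
  using sum_subset_weight_prod[of p "\<lambda>_. 1" "\<lambda>_. 1"] by simp

lemma sum_subset_weight_marginal:
  "(\<Sum>T\<in>UNIV. subset_weight p T * (if i \<in> T then 1 else 0)) = p i"
proof -
  \<comment> \<open>The indicator of \<open>i \<in> T\<close> is put in product form: a single
    factor vanishes, at \<open>i\<close>, exactly when \<open>i\<close> is absent.\<close>
  have "(\<Prod>l\<in>UNIV. if l \<in> T then 1 else if l = i then 0 else (1::real)) = (if i \<in> T then 1 else 0)"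
    for T
    by (auto intro!: prod.neutral prod_zero)
  moreover have "(\<Prod>l\<in>UNIV. p l * 1 + (1 - p l) * (if l = i then 0 else 1)) = p i"
  proof -
    have "(\<Prod>l\<in>UNIV. p l * 1 + (1 - p l) * (if l = i then 0 else 1))
        = (\<Prod>l\<in>UNIV. if l = i then p l else 1)"
      by (intro prod.cong) auto
    then show ?thesis by simp
  qed
  ultimately show ?thesis
    using sum_subset_weight_prod[of p "\<lambda>_. 1" "\<lambda>l. if l = i then 0 else 1"] by simp
qed

text \<open>With \<open>T\<close> drawn using the fractional parts as probabilities, the mean is
  \<open>y\<close>. An integer coordinate has fractional part 0, so any \<open>T\<close> that raises
  it has weight 0.\<close>

definition rounding :: "real^'n \<Rightarrow> 'n set \<Rightarrow> real^'n" where
  "rounding y T = (\<chi> i. of_int \<lfloor>y $ i\<rfloor> + (if i \<in> T then 1 else 0))"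

lemma rounding_props:
  assumes "nonneg_vec y"
  shows "rounding y T \<in> int_points" "nonneg_vec (rounding y T)"
  using assms by (auto simp: rounding_def int_points_def nonneg_vec_def)

lemma sum_subset_weight_rounding:
  "(\<Sum>T\<in>UNIV. subset_weight (\<lambda>i. frac (y $ i)) T * rounding y T $ i) = y $ i"
proof -
  let ?w = "subset_weight (\<lambda>i. frac (y $ i))"
  have "(\<Sum>T\<in>UNIV. ?w T * rounding y T $ i)
      = of_int \<lfloor>y $ i\<rfloor> * (\<Sum>T\<in>UNIV. ?w T) + (\<Sum>T\<in>UNIV. ?w T * (if i \<in> T then 1 else 0))"
    by (simp add: rounding_def distrib_left sum.distrib sum_distrib_left mult.commute)
  then show ?thesis
    by (simp only: sum_subset_weight sum_subset_weight_marginal) (simp add: frac_def)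
qed

text \<open>By convexity, \<open>2 powr (- a)\<close> lies below its chord between 0 and 1.\<close>

lemma powr_minus_le_chord:
  assumes "0 \<le> a" "a \<le> (1::real)"
  shows "2 powr (- a) \<le> 1 - a / 2"
proof -
  have "exp ((1 - a) *\<^sub>R 0 + a *\<^sub>R (- ln 2)) \<le> (1 - a) * exp 0 + a * exp (- ln 2 :: real)"
    using assms by (intro convex_onD[OF exp_convex]) auto
  then show ?thesis by (simp add: powr_def exp_minus)
qed

lemma half_le_ln_2: "1 / 2 \<le> ln (2::real)"
  using ln_le_minus_one[of "1/2::real"] by (simp add: ln_div)

text \<open>The exponential moment of one rounded coordinate. The integer part is handled by
  \<open>1 / 2 \<le> ln 2\<close>, the fractional part by the chord bound and
  \<open>1 + u \<le> exp u\<close>.\<close>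

lemma rounding_factor_bound:
  assumes "0 \<le> a" "a \<le> 1" "0 \<le> (t::real)"
  shows "frac t * 2 powr (- (a * (of_int \<lfloor>t\<rfloor> + 1))) + (1 - frac t) * 2 powr (- (a * of_int \<lfloor>t\<rfloor>))
    \<le> exp (- (a * t / 2))"
proof -
  define m where "m = real_of_int \<lfloor>t\<rfloor>"
  define p where "p = frac t"
  have p: "0 \<le> p" "p \<le> 1" "t = m + p" and m: "0 \<le> m"
    using assms by (auto simp: p_def m_def frac_def less_imp_le frac_lt_1)
       (metis frac_def frac_lt_1 less_imp_le)
  have "p * 2 powr (- (a * (m + 1))) + (1 - p) * 2 powr (- (a * m))
      = 2 powr (- (a * m)) * (p * 2 powr (- a) + (1 - p))"
    by (simp add: algebra_simps flip: powr_add)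
  also have "\<dots> \<le> exp (- (a * m / 2)) * exp (- (p * a / 2))"
  proof (rule mult_mono)
    have "a * m * (1 / 2) \<le> a * m * ln 2"
      using assms m half_le_ln_2 by (intro mult_left_mono) auto
    then show "2 powr (- (a * m)) \<le> exp (- (a * m / 2))"
      by (simp add: powr_def)
    have "p * 2 powr (- a) + (1 - p) \<le> p * (1 - a / 2) + (1 - p)"
      using powr_minus_le_chord[of a] assms p by (intro add_right_mono mult_left_mono) auto
    also have "\<dots> = 1 + (- (p * a / 2))" by (simp add: algebra_simps)
    also have "\<dots> \<le> exp (- (p * a / 2))" by (rule exp_ge_add_one_self)
    finally show "p * 2 powr (- a) + (1 - p) \<le> exp (- (p * a / 2))" .
  qed (use p in auto)
  also have "\<dots> = exp (- (a * t / 2))"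
    by (simp add: p(3) flip: exp_add) (simp add: algebra_simps)
  finally show ?thesis by (simp add: m_def p_def)
qed

text \<open>Markov's inequality for \<open>2 powr (1 - a \<bullet> rounding y T)\<close>, which is
  at least 1 on the failure event; independence factors its mean into one-coordinate
  moments.\<close>

lemma rounding_chernoff:
  fixes a y :: "real^'n"
  assumes a: "\<And>i. 0 \<le> a $ i" "\<And>i. a $ i \<le> 1" and y: "nonneg_vec y"
  shows "(\<Sum>T | a \<bullet> rounding y T < 1. subset_weight (\<lambda>i. frac (y $ i)) T) \<le> 2 * exp (- (a \<bullet> y) / 2)"
proof -
  let ?w = "subset_weight (\<lambda>i. frac (y $ i))"
  let ?m = "\<lambda>i. real_of_int \<lfloor>y $ i\<rfloor>"
  have w: "0 \<le> ?w T" for T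
    by (rule subset_weight_nonneg) (auto simp: less_imp_le frac_lt_1)
  have "(\<Sum>T | a \<bullet> rounding y T < 1. ?w T)
      \<le> (\<Sum>T | a \<bullet> rounding y T < 1. ?w T * 2 powr (1 - a \<bullet> rounding y T))"
  proof (intro sum_mono)
    fix T assume "T \<in> {T. a \<bullet> rounding y T < 1}"
    then have "1 \<le> 2 powr (1 - a \<bullet> rounding y T)" by (simp add: ge_one_powr_ge_zero)
    then show "?w T \<le> ?w T * 2 powr (1 - a \<bullet> rounding y T)"
      using mult_left_mono[OF _ w, of 1] by fastforce
  qed
  also have "\<dots> \<le> (\<Sum>T\<in>UNIV. ?w T * 2 powr (1 - a \<bullet> rounding y T))"
    using w by (intro sum_mono2) auto
  also have "\<dots> = 2 * (\<Sum>T\<in>UNIV. ?w T * (\<Prod>i\<in>UNIV. if i \<in> T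
      then 2 powr (- (a $ i * (?m i + 1))) else 2 powr (- (a $ i * ?m i))))"
  proof -
    have "2 powr (1 - a \<bullet> rounding y T) = 2 * (\<Prod>i\<in>UNIV. if i \<in> T
      then 2 powr (- (a $ i * (?m i + 1))) else 2 powr (- (a $ i * ?m i)))" for T
    proof -
      have "2 powr (1 - a \<bullet> rounding y T) = 2 * 2 powr (\<Sum>i\<in>UNIV. - (a $ i * rounding y T $ i))"
        by (simp add: powr_diff powr_minus inner_vec_def sum_negf divide_inverse)
      also have "2 powr (\<Sum>i\<in>UNIV. - (a $ i * rounding y T $ i))
          = (\<Prod>i\<in>UNIV. 2 powr (- (a $ i * rounding y T $ i)))"
        by (rule powr_sum) auto
      also have "\<dots> = (\<Prod>i\<in>UNIV. if i \<in> T
          then 2 powr (- (a $ i * (?m i + 1))) else 2 powr (- (a $ i * ?m i)))"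
        by (intro prod.cong) (auto simp: rounding_def)
      finally show ?thesis .
    qed
    then show ?thesis by (simp add: sum_distrib_left mult.left_commute)
  qed
  also have "\<dots> = 2 * (\<Prod>i\<in>UNIV. frac (y $ i) * 2 powr (- (a $ i * (?m i + 1)))
      + (1 - frac (y $ i)) * 2 powr (- (a $ i * ?m i)))"
    by (simp only: sum_subset_weight_prod)
  also have "\<dots> \<le> 2 * (\<Prod>i\<in>UNIV. exp (- (a $ i * y $ i / 2)))"
  proof (intro mult_left_mono prod_mono conjI)
    fix i
    show "0 \<le> frac (y $ i) * 2 powr (- (a $ i * (?m i + 1)))
        + (1 - frac (y $ i)) * 2 powr (- (a $ i * ?m i))"
      by (intro add_nonneg_nonneg mult_nonneg_nonneg) (auto simp: less_imp_le frac_lt_1)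
    show "frac (y $ i) * 2 powr (- (a $ i * (?m i + 1)))
        + (1 - frac (y $ i)) * 2 powr (- (a $ i * ?m i)) \<le> exp (- (a $ i * y $ i / 2))"
      using a y by (intro rounding_factor_bound) (auto simp: nonneg_vec_def)
  qed auto
  also have "\<dots> = 2 * exp (- (a \<bullet> y) / 2)"
    by (simp add: inner_vec_def sum_divide_distrib sum_negf flip: exp_sum)
  finally show ?thesis .
qed

text \<open>The union bound, for the failure events of the \<open>k\<close> inequalities.\<close>

lemma sum_UN_le:
  fixes w :: "'a \<Rightarrow> real"
  assumes "finite I" "\<And>i. i \<in> I \<Longrightarrow> finite (B i)" "\<And>x. 0 \<le> w x"
  shows "sum w (\<Union>i\<in>I. B i) \<le> (\<Sum>i\<in>I. sum w (B i))"
  using assms(1,2)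
proof (induction I)
  case (insert i I)
  have "sum w (\<Union>i\<in>insert i I. B i) + sum w (B i \<inter> (\<Union>i\<in>I. B i))
      = sum w (B i) + sum w (\<Union>i\<in>I. B i)"
    using insert by (simp add: sum.union_inter)
  moreover have "0 \<le> sum w (B i \<inter> (\<Union>i\<in>I. B i))"
    by (intro sum_nonneg assms(3))
  moreover have "sum w (\<Union>i\<in>I. B i) \<le> (\<Sum>i\<in>I. sum w (B i))"
    using insert by simp
  ultimately show ?case using insert by simp
qed simp

lemma rounding_in_convex_hull:
  fixes D :: "nat \<Rightarrow> real^'n" and x :: "real^'n"
  assumes k: "k \<ge> 1" and x: "nonneg_vec x"
    and D: "\<And>j i. j < k \<Longrightarrow> 0 \<le> D j $ i" "\<And>j i. j < k \<Longrightarrow> D j $ i \<le> f j"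
    and Dx: "\<And>j. j < k \<Longrightarrow> f j \<le> D j \<bullet> x"
  shows "(8 * log 2 (2 * real k)) *\<^sub>R x
    \<in> convex hull {z \<in> int_points. nonneg_vec z \<and> (\<forall>j<k. f j \<le> D j \<bullet> z)}"
    (is "_ \<in> convex hull ?X")
proof -
  define L where "L = log 2 (2 * real k)"
  \<comment> \<open>The factor 4 gives the tail bound \<open>2 * exp (- 2 * L)\<close>, which is at
    most \<open>2 powr (1 - 2 * L)\<close> and, as \<open>L \<ge> 1\<close>, at most
    \<open>2 powr (- L) = 1 / (2 * real k)\<close>.\<close>
  define y where "y = (4 * L) *\<^sub>R x"
  define w where "w = subset_weight (\<lambda>i. frac (y $ i))"
  have L1: "1 \<le> L" and L2: "2 powr L = 2 * real k"
    using k by (simp_all add: L_def le_log_iff)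
  have yn: "nonneg_vec y" using x L1 by (simp add: y_def nonneg_vec_def)
  have w0: "0 \<le> w T" for T
    unfolding w_def by (rule subset_weight_nonneg) (auto simp: less_imp_le frac_lt_1)
  have bad: "(\<Sum>T | D j \<bullet> rounding y T < f j. w T) \<le> 1 / (2 * real k)" if j: "j < k" for j
  proof (cases "0 < f j")
    \<comment> \<open>Scaling to right-hand side 1 is impossible here, but so is failure.\<close>
    case False
    have "f j \<le> D j \<bullet> rounding y T" for T
    proof -
      have "0 \<le> D j \<bullet> rounding y T"
        using D(1)[OF j] rounding_props(2)[OF yn]
        by (auto simp: inner_vec_def nonneg_vec_def intro!: sum_nonneg)
      with False show ?thesis by simp
    qed
    then have "{T. D j \<bullet> rounding y T < f j} = {}" by (simp add: not_less)
    then show ?thesis by simp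
  next
    case True
    \<comment> \<open>The bound \<open>D j $ i \<le> f j\<close> puts the entries of
      \<open>a\<close> in the unit interval, as the tail estimate requires.\<close>
    define a where "a = (1 / f j) *\<^sub>R D j"
    have "1 \<le> a \<bullet> x" using Dx[OF j] True by (simp add: a_def pos_le_divide_eq)
    then have "4 * L * 1 \<le> 4 * L * (a \<bullet> x)" using L1 by (intro mult_left_mono) auto
    then have ay: "4 * L \<le> a \<bullet> y" by (simp add: y_def)
    have "{T. D j \<bullet> rounding y T < f j} = {T. a \<bullet> rounding y T < 1}"
      using True by (simp add: a_def pos_divide_less_eq)
    then have "(\<Sum>T | D j \<bullet> rounding y T < f j. w T) \<le> 2 * exp (- (a \<bullet> y) / 2)"
      using rounding_chernoff[of a y] D[OF j] True yn by (simp add: a_def w_def pos_divide_le_eq)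
    also have "\<dots> \<le> 2 * exp (- 2 * L)" using ay by simp
    also have "exp (- 2 * L) \<le> 2 powr (- 2 * L)"
      using L1 ln_2_less_1 by (simp add: powr_def)
    also have "2 * 2 powr (- 2 * L) = 2 powr (1 - 2 * L)"
      by (simp add: powr_diff powr_minus divide_inverse)
    also have "\<dots> \<le> 2 powr (- L)" using L1 by simp
    also have "\<dots> = 1 / (2 * real k)" 
      using L2 by (simp add: powr_minus_divide)
    finally show ?thesis by simp
  qed
  define G where "G = {T. \<forall>j<k. f j \<le> D j \<bullet> rounding y T}"
  define g where "g = sum w G"
  have "1 = g + sum w (- G)"
    using sum.subset_diff[of G UNIV w] sum_subset_weight[of "\<lambda>i. frac (y $ i)"]
    by (simp add: w_def g_def Compl_eq_Diff_UNIV)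
  also have "- G = (\<Union>j<k. {T. D j \<bullet> rounding y T < f j})"
    by (auto simp: G_def not_le)
  also have "sum w \<dots> \<le> (\<Sum>j<k. \<Sum>T | D j \<bullet> rounding y T < f j. w T)"
    using w0 by (intro sum_UN_le) auto
  also have "\<dots> \<le> (\<Sum>j<k. 1 / (2 * real k))" using bad by (intro sum_mono) auto
  also have "\<dots> = 1 / 2" using k by simp
  finally have g: "1 / 2 \<le> g" by simp
  \<comment> \<open>\<open>v\<close> is the mean of the rounding conditioned on \<open>G\<close>.
    Since \<open>g \<ge> 1 / 2\<close>, it lies below twice \<open>y\<close>, which is
    \<open>8 * L\<close> times \<open>x\<close>.\<close>
  define v where "v = (\<Sum>T\<in>G. (w T / g) *\<^sub>R rounding y T)"
  have "v \<in> convex hull ?X"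
    unfolding v_def
  proof (intro convex_sum[OF _ convex_convex_hull])
    show "(\<Sum>T\<in>G. w T / g) = 1"
      using g by (simp add: g_def flip: sum_divide_distrib)
    show "rounding y T \<in> convex hull ?X" if "T \<in> G" for T
      using that rounding_props[OF yn] by (intro hull_inc) (simp add: G_def)
  qed (use w0 g in auto)
  moreover have "v $ i \<le> ((8 * log 2 (2 * real k)) *\<^sub>R x) $ i" for i
  proof -
    have nn: "0 \<le> w T * rounding y T $ i" for T
      using w0 rounding_props(2)[OF yn] by (simp add: nonneg_vec_def)
    have "v $ i = (\<Sum>T\<in>G. w T * rounding y T $ i) / g"
      by (simp add: v_def sum_divide_distrib)
    also have "\<dots> \<le> y $ i / (1 / 2)"
    proof (rule frac_le)
      have "(\<Sum>T\<in>G. w T * rounding y T $ i) \<le> (\<Sum>T\<in>UNIV. w T * rounding y T $ i)"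
        using nn by (intro sum_mono2) auto
      then show "(\<Sum>T\<in>G. w T * rounding y T $ i) \<le> y $ i"
        by (simp add: w_def sum_subset_weight_rounding)
    qed (use g yn in \<open>auto simp: nonneg_vec_def\<close>)
    finally show ?thesis by (simp add: y_def L_def)
  qed
  moreover have "int_upclosed ?X"
    using D by (intro int_upclosed_covering) (simp add: nonneg_vec_def)
  ultimately show ?thesis by (meson convex_hull_int_upclosed_mono)
qed

section \<open>Growth of points and optimal values under the closure\<close>

text \<open>Rounding is applied to the truncated inequalities \<open>E\<close>. Their coefficients
  are at most those of \<open>D\<close>, so on the non-negative orthant their solutions also satisfy
  \<open>D\<close>, and hull membership carries over.\<close>

lemma scaled_in_aggregation_closure:
  fixes x :: "real^'n"
  assumes Q: "deletion_stable Q" and k: "k \<ge> 1" and x: "x \<in> Q"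
  shows "(8 * log 2 (2 * real k)) *\<^sub>R x \<in> aggregation_closure k Q"
  unfolding aggregation_closure_def
proof clarify
  fix D :: "nat \<Rightarrow> real^'n" and f
  assume v: "\<forall>j<k. valid_covering_ineq Q (D j) (f j)"
  define E where "E j = (\<chi> i. min (D j $ i) (f j))" for j
  have "(8 * log 2 (2 * real k)) *\<^sub>R x
    \<in> convex hull {z \<in> int_points. nonneg_vec z \<and> (\<forall>j<k. f j \<le> E j \<bullet> z)}"
  proof (rule rounding_in_convex_hull[OF k])
    show "nonneg_vec x" using Q x by (simp add: deletion_stable_def)
    show "f j \<le> E j \<bullet> x" if "j < k" for j
      unfolding E_def using truncated_ineq_valid[OF Q _ x] v that by blast
  qed (use v in \<open>auto simp: E_def valid_covering_ineq_def nonneg_vec_def\<close>)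
  moreover have "E j \<bullet> z \<le> D j \<bullet> z" if "nonneg_vec z" for j z
    using that unfolding inner_vec_def
    by (intro sum_mono) (auto simp: E_def nonneg_vec_def intro: mult_right_mono)
  then have "{z \<in> int_points. nonneg_vec z \<and> (\<forall>j<k. f j \<le> E j \<bullet> z)}
      \<subseteq> {z \<in> int_points. nonneg_vec z \<and> (\<forall>j<k. f j \<le> D j \<bullet> z)}"
    by (auto intro: order_trans)
  ultimately show "(8 * log 2 (2 * real k)) *\<^sub>R x
      \<in> convex hull {z \<in> int_points. nonneg_vec z \<and> (\<forall>j<k. f j \<le> D j \<bullet> z)}"
    using hull_mono by blast
qed

text \<open>Stability is part of the induction because the scaling step needs it for the current
  iterate.\<close>

lemma scaled_in_iterated_closure:
  fixes x :: "real^'n"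
  assumes Q: "deletion_stable Q" and k: "k \<ge> 1" and x: "x \<in> Q"
  shows "deletion_stable ((aggregation_closure k ^^ t) Q) \<and>
    (8 * log 2 (2 * real k)) ^ t *\<^sub>R x \<in> (aggregation_closure k ^^ t) Q"
proof (induction t)
  case (Suc t)
  then show ?case
    using scaled_in_aggregation_closure[OF _ k] deletion_stable_aggregation_closure
    by (fastforce simp flip: scaleR_scaleR)
qed (use Q x in simp)

theorem theorem5:
  fixes A :: "real^'n^'m" and b :: "real^'m" and c :: "real^'n" and k :: nat
    and Q :: "(real^'n) set" and zLP zI :: ereal
  assumes "\<forall>i j. A $ i $ j \<in> \<rat> \<and> 0 \<le> A $ i $ j"
    and "\<forall>i. b $ i \<in> \<rat> \<and> 0 \<le> b $ i"
    and "\<forall>i j. A $ i $ j \<le> b $ i"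
    and "Q = covering_polyhedron A b"
    and "k \<ge> 1"
    and "nonneg_vec c"
    and "zLP = opt_value c Q"
    and "zI = opt_value c (integer_hull Q)"
    and "0 < zLP" and "zLP < \<infinity>"
  shows "ereal_of_enat (aggregation_rank k Q) \<ge>
    ereal (real_of_int \<lceil>log 2 (real_of_ereal zI / real_of_ereal zLP) /
                        (3 + log 2 (log 2 (2 * real k)))\<rceil>)"
proof -
  define L where "L = log 2 (2 * real k)"
  define \<alpha> where "\<alpha> = 8 * L"
  define r where "r = log 2 (real_of_ereal zI / real_of_ereal zLP) / (3 + log 2 L)"
  have L1: "1 \<le> L" using \<open>k \<ge> 1\<close> by (simp add: L_def le_log_iff)
  \<comment> \<open>The 3 is \<open>log 2 8\<close>; \<open>L \<ge> 1\<close> makes the denominator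
    positive.\<close>
  then have den: "3 + log 2 L = log 2 \<alpha>" "0 < log 2 \<alpha>" "0 < \<alpha>"
    using log_of_power_eq[of 8 2 3]
    by (simp_all add: \<alpha>_def log_mult add_pos_nonneg)
  have Q: "deletion_stable Q"
    using assms(3) by (simp add: \<open>Q = covering_polyhedron A b\<close> deletion_stable_covering_polyhedron)
  obtain z where z: "zLP = ereal z" "0 < z"
    using \<open>0 < zLP\<close> \<open>zLP < \<infinity>\<close> by (cases zLP) auto
  have "Q \<noteq> {}" using \<open>zLP < \<infinity>\<close> \<open>zLP = opt_value c Q\<close> by (auto simp: opt_value_def top_ereal_def)
  then obtain x0 where x0: "x0 \<in> Q" by blast
  have bound: "r \<le> real t" if t: "(aggregation_closure k ^^ t) Q = integer_hull Q" for t
  proof -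
    have stable: "deletion_stable (integer_hull Q)"
      and scaled: "\<alpha> ^ t *\<^sub>R x \<in> integer_hull Q" if "x \<in> Q" for x
      using scaled_in_iterated_closure[OF Q \<open>k \<ge> 1\<close> that, of t] t by (simp_all add: \<alpha>_def L_def)
    have le: "zI \<le> ereal (\<alpha> ^ t * (c \<bullet> x))" if "x \<in> Q" for x
      using INF_lower[OF scaled[OF that], of "\<lambda>x. ereal (c \<bullet> x)"] by (simp add: assms opt_value_def)
    have "0 \<le> c \<bullet> x" if "x \<in> integer_hull Q" for x
      using that stable[OF x0] \<open>nonneg_vec c\<close>
      by (auto simp: deletion_stable_def nonneg_vec_def inner_vec_def intro!: sum_nonneg)
    then have "0 \<le> zI" unfolding \<open>zI = opt_value c (integer_hull Q)\<close> opt_value_def by (intro INF_greatest) simp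
    \<comment> \<open>The value at the multiple \<open>\<alpha> ^ t\<close> of \<open>x0\<close>
      bounds \<open>zI\<close> from above, so it is finite.\<close>
    then obtain Z where Z: "zI = ereal Z" "0 \<le> Z" using le[OF x0] by (cases zI) auto
    \<comment> \<open>Dividing by \<open>\<alpha> ^ t\<close> turns \<open>le\<close> into one lower
      bound for all of \<open>Q\<close>, which passes to the infimum.\<close>
    have "ereal (Z / \<alpha> ^ t) \<le> zLP"
      unfolding \<open>zLP = opt_value c Q\<close> opt_value_def
      using le den(3) by (intro INF_greatest) (simp add: Z pos_divide_le_eq mult.commute)
    then have Zz: "Z / z \<le> \<alpha> ^ t" using z den(3) by (simp add: field_simps)
    have "log 2 (Z / z) \<le> real t * log 2 \<alpha>"
    proof (cases "Z = 0")
      \<comment> \<open>The logarithm of 0 takes its default value 0.\<close>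
      case True
      then show ?thesis using den(2) mult_nonneg_nonneg[of "real t" "log 2 \<alpha>"]
        by (simp only: log_def) simp
    next
      case False
      then have "log 2 (Z / z) \<le> log 2 (\<alpha> ^ t)" using Zz Z z by (intro log_mono) auto
      then show ?thesis using den(3) by (simp add: log_nat_power)
    qed
    then show ?thesis using den by (simp add: r_def Z z pos_divide_le_eq)
  qed
  \<comment> \<open>If no iterate equals the integer hull, the rank is \<open>\<infinity>\<close>.
    This covers an empty hull, since every iterate contains a multiple of \<open>x0\<close>.\<close>
  have "enat (nat \<lceil>r\<rceil>) \<le> aggregation_rank k Q"
    unfolding aggregation_rank_def using bound by (auto intro!: Inf_greatest simp: nat_le_iff ceiling_le_iff)
  then have "ereal_of_enat (enat (nat \<lceil>r\<rceil>)) \<le> ereal_of_enat (aggregation_rank k Q)"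
    by (simp only: ereal_of_enat_le_iff)
  \<comment> \<open>\<open>nat\<close> replaces a negative ceiling by 0, which only strengthens the
    bound.\<close>
  moreover have "ereal (real_of_int \<lceil>r\<rceil>) \<le> ereal_of_enat (enat (nat \<lceil>r\<rceil>))" by simp
  ultimately show ?thesis unfolding r_def L_def by (rule order_trans[rotated])
qed

end
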